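(* For every integer $n\ge 1$ with $n\ne 5$, $$\mathrm{ex}(n,C_3^{\square})=\begin{cases}\left\lfloor\frac{n^2}{4}\right\rfloor+\left\lfloor\frac{n-1}{2}\right\rfloor, & \text{if } n\equiv 1,2,3 \pmod 6,\\[1mm] \left\lfloor\frac{n^2}{4}\right\rfloor+\left\lceil\frac{n}{2}\right\rceil, & \text{otherwise.}\end{cases}$$
   Context: All graphs are finite, simple and undirected. $\mathrm{ex}(n,H)$ denotes the maximum number of edges of an $n$-vertex graph containing no subgraph (not necessarily induced) isomorphic to $H$. The triangular prism $C_3^{\square}=C_3\square K_2$ is the 6-vertex graph consisting of two vertex-disjoint triangles $u_1u_2u_3$ and $w_1w_2w_3$ together with the edges $u_1w_1,u_2w_2,u_3w_3$. *)

theory Defs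
  imports Complex_Main
begin

datatype 'a sgraph = Graph (verts: "'a set") (edges: "'a set set")

definition simple_graph :: "'a sgraph \<Rightarrow> bool" where
  "simple_graph G \<longleftrightarrow> finite (verts G) \<and> (\<forall>e \<in> edges G. e \<subseteq> verts G \<and> card e = 2)"

definition subgraph :: "'a sgraph \<Rightarrow> 'a sgraph \<Rightarrow> bool" where
  "subgraph H G \<longleftrightarrow>
     simple_graph H \<and> simple_graph G \<and> verts H \<subseteq> verts G \<and> edges H \<subseteq> edges G"

definition isomorphic :: "'a sgraph \<Rightarrow> 'b sgraph \<Rightarrow> bool" where
  "isomorphic G H \<longleftrightarrow>
     (\<exists>f. bij_betw f (verts G) (verts H) \<and> edges H = (\<lambda>e. f ` e) ` edges G)"

definition contains_copy :: "'a sgraph \<Rightarrow> 'b sgraph \<Rightarrow> bool" where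
  "contains_copy G H \<longleftrightarrow> (\<exists>H'. subgraph H' G \<and> isomorphic H' H)"

text \<open>
  Every finite graph is isomorphic to one whose vertices are natural numbers, so it is
  enough to let the graph range over \<open>nat sgraph\<close>. The maximum is taken over a
  finite set, and this set is nonempty whenever \<open>H\<close> has an edge
  (lemmas \<open>finite_ex_set\<close> and \<open>nonempty_ex_set\<close> below).
\<close>

definition ex :: "nat \<Rightarrow> 'a sgraph \<Rightarrow> nat" where
  "ex n H = Max {card (edges G) | G :: nat sgraph.
     simple_graph G \<and> card (verts G) = n \<and> \<not> contains_copy G H}"

text \<open>The vertex \<open>u\<^sub>i\<close> is \<open>(i, False)\<close> and \<open>w\<^sub>i\<close> is \<open>(i, True)\<close>.\<close>

definition prism :: "(nat \<times> bool) sgraph" where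
  "prism = Graph ({1, 2, 3} \<times> {False, True})
     {{(1, False), (2, False)}, {(2, False), (3, False)}, {(1, False), (3, False)},
      {(1, True), (2, True)}, {(2, True), (3, True)}, {(1, True), (3, True)},
      {(1, False), (1, True)}, {(2, False), (2, True)}, {(3, False), (3, True)}}"

lemma simple_graph_prism: "simple_graph prism"
  by (auto simp: simple_graph_def prism_def)

lemma finite_ex_set:
  "finite {card (edges G) | G :: nat sgraph.
     simple_graph G \<and> card (verts G) = n \<and> \<not> contains_copy G H}"
proof (rule finite_subset)
  show "{card (edges G) | G :: nat sgraph.
     simple_graph G \<and> card (verts G) = n \<and> \<not> contains_copy G H} \<subseteq> {.. 2 ^ n}"
  proof (rule subsetI)
    fix k
    assume "k \<in> {card (edges G) | G :: nat sgraph.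
      simple_graph G \<and> card (verts G) = n \<and> \<not> contains_copy G H}"
    then obtain G :: "nat sgraph"
      where G: "k = card (edges G)" "simple_graph G" "card (verts G) = n"
      by blast
    then have "finite (verts G)" "edges G \<subseteq> Pow (verts G)"
      by (auto simp: simple_graph_def)
    then have "card (edges G) \<le> 2 ^ card (verts G)"
      by (metis card_Pow card_mono finite_Pow_iff)
    with G show "k \<in> {.. 2 ^ n}" by simp
  qed
qed simp

lemma nonempty_ex_set:
  assumes "edges H \<noteq> {}"
  shows "{card (edges G) | G :: nat sgraph.
     simple_graph G \<and> card (verts G) = n \<and> \<not> contains_copy G H} \<noteq> {}"
proof -
  have "\<not> contains_copy (Graph {..<n} {}) H"
    using assms by (auto simp: contains_copy_def subgraph_def isomorphic_def)
  moreover have "simple_graph (Graph {..<n} {})" "card (verts (Graph {..<n} {})) = n"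
    by (auto simp: simple_graph_def)
  ultimately show ?thesis by blast
qed

end

theory Submission
  imports Defs
begin

text \<open>
  The upper bound is proved by induction on the number of vertices. A minimal counterexample
  with one edge too many satisfies,
    for every vertex set \<open>S\<close>, an inequality between the degree sum
  over \<open>S\<close> and the number of edges inside \<open>S\<close>, since deleting \<open>S\<close> leaves a graph obeying the bound.
  For \<open>|S| = 1\<close> this bounds the minimum degree, which contradicts the handshake lemma when
  \<open>n mod 6\<close> is 3, 4 or 5. If \<open>n mod 6 = 0\<close>, the graph is almost regular and triangles must contain a
  vertex of surplus degree, which is impossible for common neighbours of most edges.
  In the remaining cases, prism-freeness shows that a vertex has at most two neighbours on
  the rim of a wheel \<open>W\<^sub>4\<close> and,
    if there is no such wheel, on a path of four vertices contained in a
  neighbourhood. Counting the edges leaving the rim or the path, together with the inequality for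
  four and five vertices, excludes both. Neighbourhoods then contain no path on four
  vertices, so that edges lie in copies of \<open>K\<^sub>4\<close> with too few outgoing edges or without surplus degree.

  The bound is attained by complete bipartite graphs with disjoint triangles added inside one part.
\<close>

text \<open>The claimed value inside the natural numbers: \<open>(n + 1) div 2\<close> is the
  ceiling of n/2. Floors and ceilings of reals occur only in the last theorem.\<close>

definition turan_prism :: "nat \<Rightarrow> nat" where
  "turan_prism n =
     n\<^sup>2 div 4 + (if n mod 6 \<in> {1, 2, 3} then (n - 1) div 2 else (n + 1) div 2)"

text \<open>On each residue class modulo 6 the bound is a quadratic polynomial in \<open>k\<close>.
  The residues 0, 1 and 2 reappear as 6k+6, 6k+7 and 6k+8, so that deleting up to five vertices from
  them keeps the same \<open>k\<close>. The square is the product \<open>k*k\<close>, a single atom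
  for linear arithmetic.\<close>

lemma turan_prism_closed_forms:
  "turan_prism (6*k) = 9*(k*k) + 3*k"
  "turan_prism (6*k+1) = 9*(k*k) + 6*k"
  "turan_prism (6*k+2) = 9*(k*k) + 9*k + 1"
  "turan_prism (6*k+3) = 9*(k*k) + 12*k + 3"
  "turan_prism (6*k+4) = 9*(k*k) + 15*k + 6"
  "turan_prism (6*k+5) = 9*(k*k) + 18*k + 9"
  "turan_prism (6*k+6) = 9*(k*k) + 21*k + 12"
  "turan_prism (6*k+7) = 9*(k*k) + 24*k + 15"
  "turan_prism (6*k+8) = 9*(k*k) + 27*k + 19"
proof -
  have m: "(6*k+1) mod 6 = 1" "(6*k+2) mod 6 = 2" "(6*k+3) mod 6 = 3"
    "(6*k+4) mod 6 = 4" "(6*k+5) mod 6 = 5" "(6*k+6) mod 6 = 0" "(6*k+7) mod 6 = 1"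
    "(6*k+8) mod 6 = 2"
    by presburger+
  show "turan_prism (6*k) = 9*(k*k) + 3*k"
    "turan_prism (6*k+1) = 9*(k*k) + 6*k"
    "turan_prism (6*k+2) = 9*(k*k) + 9*k + 1"
    "turan_prism (6*k+3) = 9*(k*k) + 12*k + 3"
    "turan_prism (6*k+4) = 9*(k*k) + 15*k + 6"
    "turan_prism (6*k+5) = 9*(k*k) + 18*k + 9"
    "turan_prism (6*k+6) = 9*(k*k) + 21*k + 12"
    "turan_prism (6*k+7) = 9*(k*k) + 24*k + 15"
    "turan_prism (6*k+8) = 9*(k*k) + 27*k + 19"
    unfolding turan_prism_def m by (simp_all add: power2_eq_square algebra_simps)
qed

section \<open>Degrees and double counting\<close>

lemma sum_card_neighbours:
  assumes "finite S" "finite F" and two: "\<And>e. e \<in> F \<Longrightarrow> card e = 2"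
  shows "(\<Sum>x\<in>S. card {y. {x, y} \<in> F}) = (\<Sum>e\<in>F. card (e \<inter> S))"
proof -
  \<comment> \<open>Sending \<open>y\<close> to \<open>{x, y}\<close> turns neighbours of
    \<open>x\<close> into edges through \<open>x\<close>; the order of summation can then be
    swapped.\<close>
  have "card {y. {x, y} \<in> F} = card {e\<in>F. x \<in> e}" for x
  proof (rule bij_betw_same_card)
    show "bij_betw (\<lambda>y. {x, y}) {y. {x, y} \<in> F} {e\<in>F. x \<in> e}"
      unfolding bij_betw_def
    proof
      show "inj_on (\<lambda>y. {x, y}) {y. {x, y} \<in> F}"
        by (auto simp: inj_on_def doubleton_eq_iff)
      show "(\<lambda>y. {x, y}) ` {y. {x, y} \<in> F} = {e\<in>F. x \<in> e}"
      proof (intro equalityI subsetI)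
        fix e assume e: "e \<in> {e\<in>F. x \<in> e}"
        then obtain a b where ab: "e = {a, b}" using two
          by (metis (no_types, lifting) card_2_iff mem_Collect_eq)
        with e have "x = a \<or> x = b" by auto
        then have "e = {x, a} \<or> e = {x, b}" using ab by auto
        then show "e \<in> (\<lambda>y. {x, y}) ` {y. {x, y} \<in> F}" using e by auto
      qed auto
    qed
  qed
  then have "(\<Sum>x\<in>S. card {y. {x, y} \<in> F}) = (\<Sum>x\<in>S. \<Sum>e | e \<in> F \<and> x \<in> e. 1)"
    by simp
  also have "\<dots> = (\<Sum>e\<in>F. \<Sum>x | x \<in> S \<and> x \<in> e. 1)"
    by (rule sum.swap_restrict) (use assms in auto)
  also have "\<dots> = (\<Sum>e\<in>F. card (e \<inter> S))"
    by (rule sum.cong) (auto intro!: arg_cong[where f = card])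
  finally show ?thesis .
qed

text \<open>At most one element of \<open>P\<close> lies outside \<open>A\<close>. If there is none,
  any element of \<open>P\<close> serves as \<open>q\<close>, so \<open>q\<close> may belong to
  \<open>A\<close>.\<close>

lemma card_Int_gt_2E:
  assumes "finite P" "card P = 4" "\<not> card (A \<inter> P) \<le> 2"
  obtains q where "q \<in> P" "P - {q} \<subseteq> A"
proof -
  have "card (A \<inter> P) + card (P - A) = card P"
    using assms(1)
      by (metis Int_commute card_Diff_subset_Int card_mono finite_Int inf_le1 le_add_diff_inverse)
  then have "card (P - A) \<le> 1" using assms by simp
  moreover have "finite (P - A)" using assms by simp
  ultimately have "P - A = {} \<or> (\<exists>q. P - A = {q})"
    by (metis card_1_singletonE card_eq_0_iff le_Suc_eq One_nat_def le_zero_eq)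
  then show thesis
  proof
    assume "P - A = {}"
    moreover obtain q where "q \<in> P" using assms(2) by fastforce
    ultimately show thesis using that by blast
  next
    assume "\<exists>q. P - A = {q}"
    then show thesis using that by blast
  qed
qed

text \<open>Prism-freeness is spelled out on six vertices instead of through
  \<open>contains_copy\<close>: this form passes to subgraphs at once and yields a contradiction as
  soon as six vertices are named. \<open>prism_free_graph_iff\<close> connects the two.\<close>

locale prism_free_graph =
  fixes V :: "'a set" and E :: "'a set set"
  assumes fin: "finite V"
    and edge: "e \<in> E \<Longrightarrow> e \<subseteq> V \<and> card e = 2"
    and no_prism: "distinct [u1, u2, u3, w1, w2, w3] \<Longrightarrow>
      {u1, u2} \<in> E \<Longrightarrow> {u2, u3} \<in> E \<Longrightarrow> {u1, u3} \<in> E \<Longrightarrow>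
      {w1, w2} \<in> E \<Longrightarrow> {w2, w3} \<in> E \<Longrightarrow> {w1, w3} \<in> E \<Longrightarrow>
      {u1, w1} \<in> E \<Longrightarrow> {u2, w2} \<in> E \<Longrightarrow> {u3, w3} \<in> E \<Longrightarrow> False"
begin

definition adj :: "'a \<Rightarrow> 'a \<Rightarrow> bool" where "adj x y \<longleftrightarrow> {x, y} \<in> E"
definition nb :: "'a \<Rightarrow> 'a set" where "nb x = {y. {x, y} \<in> E}"
definition deg :: "'a \<Rightarrow> nat" where "deg x = card (nb x)"
definition inner :: "'a set \<Rightarrow> nat" where "inner S = card {e\<in>E. e \<subseteq> S}"

lemma adj_sym: "adj x y \<Longrightarrow> adj y x"
  by (simp add: adj_def insert_commute)

lemma adj_commute: "adj x y = adj y x"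
  by (auto intro: adj_sym)

lemma adj_neq: "adj x y \<Longrightarrow> x \<noteq> y"
  using edge[of "{x, y}"] by (auto simp: adj_def)

lemma adj_V: "adj x y \<Longrightarrow> x \<in> V" "adj x y \<Longrightarrow> y \<in> V"
  using edge[of "{x, y}"] by (auto simp: adj_def)

lemma nb_iff: "y \<in> nb x \<longleftrightarrow> adj x y"
  by (simp add: nb_def adj_def)

lemma nb_irrefl: "x \<notin> nb x"
  using adj_neq nb_iff by blast

lemma nb_subset: "nb x \<subseteq> V"
  using adj_V by (auto simp: nb_iff)

lemma finite_nb: "finite (nb x)"
  using nb_subset fin finite_subset by blast

lemma finite_E: "finite E"
  using edge fin by (meson Sup_le_iff finite_UnionD finite_subset)

lemma no_prism_adj:
  assumes "distinct [u1, u2, u3, w1, w2, w3]" "adj u1 u2" "adj u2 u3" "adj u1 u3"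
    "adj w1 w2" "adj w2 w3" "adj w1 w3" "adj u1 w1" "adj u2 w2" "adj u3 w3"
  shows False
  using no_prism assms unfolding adj_def by blast

lemma sum_deg: "finite S \<Longrightarrow> (\<Sum>x\<in>S. deg x) = (\<Sum>e\<in>E. card (e \<inter> S))"
  unfolding deg_def nb_def using sum_card_neighbours[of S E] finite_E edge by blast

lemma handshake: "(\<Sum>x\<in>V. deg x) = 2 * card E"
proof -
  have "(\<Sum>e\<in>E. card (e \<inter> V)) = (\<Sum>e\<in>E. 2)"
    by (rule sum.cong) (use edge in \<open>auto simp: Int_absorb2\<close>)
  then show ?thesis using sum_deg[OF fin] by simp
qed

text \<open>For each edge, the number of its ends in \<open>S\<close>, plus 1 if it avoids
  \<open>S\<close>, equals 1, plus 1 if it lies inside \<open>S\<close>. Summing over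
  \<open>E\<close> gives the identity.\<close>

lemma sum_deg_delete:
  assumes "finite S"
  shows "(\<Sum>x\<in>S. deg x) + card {e\<in>E. e \<inter> S = {}} = card E + inner S"
proof -
  have *: "card (e \<inter> S) + (if e \<inter> S = {} then 1 else 0) = 1 + (if e \<subseteq> S then 1 else 0)"
    if "e \<in> E" for e
  proof -
    obtain a b where ab: "e = {a, b}" "a \<noteq> b" using edge[OF \<open>e \<in> E\<close>]
      by (auto simp: card_2_iff)
    show ?thesis unfolding ab(1) using ab(2)
      by (cases "a \<in> S"; cases "b \<in> S") (auto simp: Int_insert_left)
  qed
  have count: "(\<Sum>e\<in>E. if Q e then 1 else 0) = card {e\<in>E. Q e}" for Q
    using finite_E by (simp flip: sum.inter_filter)
  have "(\<Sum>x\<in>S. deg x) + card {e\<in>E. e \<inter> S = {}}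
      = (\<Sum>e\<in>E. card (e \<inter> S) + (if e \<inter> S = {} then 1 else 0))"
    unfolding sum.distrib count by (simp add: sum_deg[OF assms])
  also have "\<dots> = (\<Sum>e\<in>E. 1 + (if e \<subseteq> S then 1 else 0))"
    using * by (rule sum.cong[OF refl])
  also have "\<dots> = card E + inner S"
    unfolding sum.distrib count by (simp add: inner_def)
  finally show ?thesis .
qed

lemma sum_deg_swap:
  assumes "P \<subseteq> V"
  shows "(\<Sum>p\<in>P. deg p) = (\<Sum>z\<in>V. card (nb z \<inter> P))"
proof -
  have "finite P" using assms fin finite_subset by blast
  have "(\<Sum>p\<in>P. deg p) = (\<Sum>p\<in>P. \<Sum>z | z \<in> V \<and> adj p z. 1)"
    using adj_V by (auto simp: deg_def nb_def adj_def intro!: sum.cong arg_cong[where f = card])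
  also have "\<dots> = (\<Sum>z\<in>V. \<Sum>p | p \<in> P \<and> adj p z. 1)"
    by (rule sum.swap_restrict) (use fin \<open>finite P\<close> in auto)
  also have "\<dots> = (\<Sum>z\<in>V. card (nb z \<inter> P))"
    by (auto simp: nb_iff adj_commute intro!: sum.cong arg_cong[where f = card])
  finally show ?thesis .
qed

lemma sum_inner_deg:
  assumes "finite P"
  shows "(\<Sum>z\<in>P. card (nb z \<inter> P)) = 2 * inner P"
proof -
  let ?F = "{e\<in>E. e \<subseteq> P}"
  have "(\<Sum>z\<in>P. card (nb z \<inter> P)) = (\<Sum>z\<in>P. card {y. {z, y} \<in> ?F})"
    by (auto simp: nb_def intro!: sum.cong arg_cong[where f = card])
  also have "\<dots> = (\<Sum>e\<in>?F. card (e \<inter> P))"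
    by (rule sum_card_neighbours) (use assms finite_E edge in auto)
  also have "\<dots> = (\<Sum>e\<in>?F. 2)"
    by (rule sum.cong) (use edge in \<open>auto simp: Int_absorb2\<close>)
  finally show ?thesis by (simp add: inner_def)
qed

text \<open>Inclusion-exclusion for two neighbourhoods inside \<open>V\<close>; used to force common
  neighbours from large degrees.\<close>

lemma codegree: "deg x + deg y \<le> card (nb x \<inter> nb y) + card V"
  using card_Un_Int[of "nb x" "nb y"] card_mono[OF fin, of "nb x \<union> nb y"] nb_subset finite_nb
  by (simp add: deg_def)

lemma sum_deg_le:
  assumes "P \<subseteq> V" "Q \<subseteq> V" and Q: "\<And>z. z \<in> V - Q \<Longrightarrow> card (nb z \<inter> P) \<le> c"
  shows "(\<Sum>p\<in>P. deg p) \<le> (\<Sum>z\<in>Q. card (nb z \<inter> P)) + c * (card V - card Q)"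
proof -
  have "(\<Sum>p\<in>P. deg p) = (\<Sum>z\<in>Q. card (nb z \<inter> P)) + (\<Sum>z\<in>V - Q. card (nb z \<inter> P))"
    unfolding sum_deg_swap[OF assms(1)] using sum.subset_diff[OF assms(2) fin]
      by (simp add: add.commute)
  also have "(\<Sum>z\<in>V - Q. card (nb z \<inter> P)) \<le> of_nat (card (V - Q)) * c"
    by (rule sum_bounded_above) (rule Q)
  finally show ?thesis
    using assms(2) fin by (simp add: card_Diff_subset finite_subset mult.commute)
qed

text \<open>Counted from the other end, \<open>v\<close> contributes 4, \<open>P\<close> twice its
  inner edges, and each of the other \<open>card V - 5\<close> vertices at most 2. The 6 is 2 * 5 -
  4.\<close>

lemma sum_deg_apex_le:
  assumes P: "P \<subseteq> nb v" "card P = 4" and out: "\<And>z. z \<in> V - insert v P \<Longrightarrow> card (nb z \<inter> P) \<le> 2"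
  shows "(\<Sum>p\<in>P. deg p) + 6 \<le> 2 * inner P + 2 * card V"
proof -
  have fP: "finite P" using P(2) by (simp add: card_ge_0_finite)
  have vP: "v \<notin> P" using P(1) adj_neq nb_iff by blast
  obtain p where "p \<in> P" using P(2) by fastforce
  then have "v \<in> V" using P(1) adj_V by (auto simp: nb_iff)
  then have sub: "insert v P \<subseteq> V" using P(1) nb_subset by auto
  then have five: "5 \<le> card V" using card_mono[OF fin sub] vP fP P(2) by simp
  have "(\<Sum>p\<in>P. deg p) \<le> (\<Sum>z\<in>insert v P. card (nb z \<inter> P)) + 2 * (card V - card (insert v P))"
    using sum_deg_le[OF _ sub out] sub by blast
  also have "(\<Sum>z\<in>insert v P. card (nb z \<inter> P)) = 4 + 2 * inner P"
    using vP fP P by (simp add: sum_inner_deg Int_absorb1)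
  finally show ?thesis using vP fP P(2) five by simp
qed

section \<open>Wheels, fans and cliques\<close>

definition wheel :: "'a \<Rightarrow> 'a \<Rightarrow> 'a \<Rightarrow> 'a \<Rightarrow> 'a \<Rightarrow> bool" where
  "wheel v a b c d \<longleftrightarrow> distinct [v, a, b, c, d] \<and> adj v a \<and> adj v b \<and> adj v c \<and> adj v d
     \<and> adj a b \<and> adj b c \<and> adj c d \<and> adj d a"

text \<open>As in \<open>wheel\<close>, \<open>v\<close> is the hub and chords are allowed: the path
  need not be induced, and a \<open>wheel\<close> is a \<open>fan\<close> whose path ends are
  adjacent.\<close>

definition fan :: "'a \<Rightarrow> 'a \<Rightarrow> 'a \<Rightarrow> 'a \<Rightarrow> 'a \<Rightarrow> bool" where
  "fan v a b c d \<longleftrightarrow> distinct [v, a, b, c, d] \<and> adj v a \<and> adj v b \<and> adj v c \<and> adj v d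
     \<and> adj a b \<and> adj b c \<and> adj c d"

lemma wheel_imp_fan: "wheel v a b c d \<Longrightarrow> fan v a b c d"
  by (simp add: wheel_def fan_def)

lemma wheel_rotate: "wheel v a b c d \<Longrightarrow> wheel v b c d a"
  by (auto simp: wheel_def)

lemma fan_reverse: "fan v a b c d \<Longrightarrow> fan v d c b a"
  by (auto simp: fan_def adj_commute)

text \<open>The triangles \<open>a b v\<close> and \<open>z c d\<close>, matched by
  \<open>a z\<close>, \<open>b c\<close> and \<open>v d\<close>, form a prism.\<close>

lemma fan_second_apex:
  assumes "fan v a b c d" "z \<notin> {v, a, b, c, d}" "adj z a" "adj z c" "adj z d"
  shows False
  by (rule no_prism_adj[of a b v z c d]) (use assms in \<open>auto simp: fan_def adj_commute\<close>)

text \<open>If an outside vertex sees three rim vertices, a rotation moves the remaining one to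
  position \<open>b\<close>, and \<open>fan_second_apex\<close> applies.\<close>

lemma wheel_sum_deg:
  assumes W: "wheel v a b c d"
  shows "(\<Sum>p\<in>{a,b,c,d}. deg p) + 6 \<le> 2 * inner {a,b,c,d} + 2 * card V"
proof (rule sum_deg_apex_le)
  show "{a,b,c,d} \<subseteq> nb v" "card {a,b,c,d} = 4" using W by (auto simp: wheel_def nb_iff)
  fix z assume z: "z \<in> V - insert v {a,b,c,d}"
  show "card (nb z \<inter> {a,b,c,d}) \<le> 2"
  proof (rule ccontr)
    assume "\<not> card (nb z \<inter> {a,b,c,d}) \<le> 2"
    then obtain q where q: "q \<in> {a,b,c,d}" "{a,b,c,d} - {q} \<subseteq> nb z"
      using card_Int_gt_2E[of "{a,b,c,d}" "nb z"] \<open>card {a,b,c,d} = 4\<close> by blast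
    have "distinct [a,b,c,d]" using W by (simp add: wheel_def)
    have R: "\<And>a b c d. wheel v a b c d \<Longrightarrow> z \<notin> {v,a,b,c,d} \<Longrightarrow> {a,c,d} \<subseteq> nb z \<Longrightarrow> False"
      by (rule fan_second_apex[OF wheel_imp_fan]) (auto simp: nb_iff)
    have W2: "wheel v b c d a" and W3: "wheel v c d a b" and W4: "wheel v d a b c"
      using W wheel_rotate by blast+
    from q \<open>distinct [a,b,c,d]\<close>
    have "{a,c,d} \<subseteq> nb z \<or> {b,d,a} \<subseteq> nb z \<or> {c,a,b} \<subseteq> nb z \<or> {d,b,c} \<subseteq> nb z"
      by auto
    moreover have "z \<notin> {v,a,b,c,d}" "z \<notin> {v,b,c,d,a}" "z \<notin> {v,c,d,a,b}" "z \<notin> {v,d,a,b,c}"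
      using z by auto
    ultimately show False using R[OF W] R[OF W2] R[OF W3] R[OF W4] by argo
  qed
qed

text \<open>Suppose an outside vertex sees three vertices of the path. If the remaining one is
  inner, \<open>fan_second_apex\<close> applies, possibly after reversal; if it is an end, the
  middle one of the three is the hub of a wheel.\<close>

lemma fan_sum_deg:
  assumes F: "fan v a b c d" and no_wheel: "\<And>v a b c d. \<not> wheel v a b c d"
  shows "(\<Sum>p\<in>{a,b,c,d}. deg p) + 6 \<le> 2 * inner {a,b,c,d} + 2 * card V"
proof (rule sum_deg_apex_le)
  show "{a,b,c,d} \<subseteq> nb v" "card {a,b,c,d} = 4" using F by (auto simp: fan_def nb_iff)
  fix z assume z: "z \<in> V - insert v {a,b,c,d}"
  show "card (nb z \<inter> {a,b,c,d}) \<le> 2"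
  proof (rule ccontr)
    assume "\<not> card (nb z \<inter> {a,b,c,d}) \<le> 2"
    then obtain q where q: "q \<in> {a,b,c,d}" "{a,b,c,d} - {q} \<subseteq> nb z"
      using card_Int_gt_2E[of "{a,b,c,d}" "nb z"] \<open>card {a,b,c,d} = 4\<close> by blast
    have "distinct [a,b,c,d]" using F by (simp add: fan_def)
    have R: "\<And>a b c d. fan v a b c d \<Longrightarrow> z \<notin> {v,a,b,c,d} \<Longrightarrow> {a,c,d} \<subseteq> nb z \<Longrightarrow> False"
      by (rule fan_second_apex) (auto simp: nb_iff)
    have R': "\<And>a b c d. fan v a b c d \<Longrightarrow> z \<notin> {v,a,b,c,d} \<Longrightarrow> {a,b,c} \<subseteq> nb z \<Longrightarrow> False"
    proof -
      fix a b c d assume "fan v a b c d" "z \<notin> {v,a,b,c,d}" "{a,b,c} \<subseteq> nb z"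
      then have "wheel b a v c z" by (auto simp: fan_def wheel_def nb_iff adj_commute)
      then show False using no_wheel by blast
    qed
    from q \<open>distinct [a,b,c,d]\<close>
    have "{a,c,d} \<subseteq> nb z \<or> {d,b,a} \<subseteq> nb z \<or> {a,b,c} \<subseteq> nb z \<or> {d,c,b} \<subseteq> nb z"
      by auto
    moreover have "z \<notin> {v,a,b,c,d}" "z \<notin> {v,d,c,b,a}" using z by auto
    ultimately show False
      using R[OF F] R[OF fan_reverse[OF F]] R'[OF F] R'[OF fan_reverse[OF F]] by argo
  qed
qed

text \<open>Inside the neighbourhood of \<open>x\<close> every vertex has at least two neighbours
  and no path has four vertices, so the components there are triangles. Each forms a K4 with
  \<open>x\<close>.\<close>

lemma no_fan_K4:
  assumes no_fan: "\<And>a b c d. \<not> fan x a b c d"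
    and codeg: "\<And>u. adj x u \<Longrightarrow> 2 \<le> card (nb x \<inter> nb u)" and xu: "adj x u"
  obtains c d where "c \<noteq> d" "adj u c" "adj u d" "adj c d" "nb x \<inter> nb u = {c, d}"
proof -
  obtain c d where cd: "c \<noteq> d" "c \<in> nb x \<inter> nb u" "d \<in> nb x \<inter> nb u"
    using codeg[OF xu]
      by (metis card_le_Suc0_iff_eq finite_Int finite_nb not_less_eq_eq numeral_2_eq_2)
  \<comment> \<open>\<open>c\<close> has a neighbour \<open>w\<close> in \<open>nb x\<close> other
    than \<open>u\<close>; unless \<open>w\<close> is \<open>d\<close>, the path
    \<open>w c u d\<close> arises.\<close>
  have "nb x \<inter> nb c \<noteq> {u}" using codeg[of c] cd by (auto simp: nb_iff)
  moreover have "u \<in> nb x \<inter> nb c" using cd xu by (auto simp: nb_iff adj_commute)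
  ultimately obtain w where w: "w \<noteq> u" "w \<in> nb x \<inter> nb c" by blast
  have "w = d"
    using no_fan[of w c u d] w cd xu adj_neq unfolding fan_def by (auto simp: nb_iff adj_commute)
  then have "adj c d" using w by (simp add: nb_iff)
  \<comment> \<open>A third common neighbour \<open>z\<close> would start the path
    \<open>z u c d\<close>.\<close>
  moreover have "z \<in> {c, d}" if "z \<in> nb x \<inter> nb u" for z
    using no_fan[of z u c d] that \<open>adj c d\<close> cd xu adj_neq unfolding fan_def
      by (auto simp: nb_iff adj_commute)
  ultimately have "nb x \<inter> nb u = {c, d}" using cd by blast
  then show thesis using that[of c d] cd \<open>adj c d\<close> by (metis IntE nb_iff)
qed

lemma inner_triangle:
  assumes "adj a b" "adj b c" "adj a c"
  shows "3 \<le> inner {a, b, c}"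
proof -
  have "a \<noteq> b" "b \<noteq> c" "a \<noteq> c" using assms adj_neq by blast+
  then have "card {{a,b},{b,c},{a,c}} = 3" by (simp add: doubleton_eq_iff)
  moreover have "card {{a,b},{b,c},{a,c}} \<le> inner {a,b,c}"
    unfolding inner_def
      by (rule card_mono) (use assms finite_E in \<open>auto simp: adj_def\<close>)
  ultimately show ?thesis by simp
qed

lemma inner_insert_apex:
  assumes "finite P" "v \<notin> P" "P \<subseteq> nb v"
  shows "inner (insert v P) = card P + inner P"
proof -
  have "{e\<in>E. e \<subseteq> insert v P} = (\<lambda>p. {v, p}) ` P \<union> {e\<in>E. e \<subseteq> P}"
  proof (intro equalityI subsetI)
    fix e assume e: "e \<in> {e\<in>E. e \<subseteq> insert v P}"
    show "e \<in> (\<lambda>p. {v, p}) ` P \<union> {e\<in>E. e \<subseteq> P}"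
    proof (cases "v \<in> e")
      case True
      obtain x y where xy: "e = {x, y}" "x \<noteq> y" using edge e
        by (metis (no_types, lifting) card_2_iff mem_Collect_eq)
      then have "e = {v, x} \<and> x \<noteq> v \<or> e = {v, y} \<and> y \<noteq> v" using True
        by auto
      then show ?thesis using e by auto
    qed (use e in auto)
  qed (use assms(3) in \<open>auto simp: nb_def\<close>)
  moreover have "card ((\<lambda>p. {v, p}) ` P \<union> {e\<in>E. e \<subseteq> P}) = card ((\<lambda>p. {v, p}) ` P) + card {e\<in>E. e \<subseteq> P}"
    by (rule card_Un_disjoint) (use assms finite_E in auto)
  moreover have "card ((\<lambda>p. {v, p}) ` P) = card P"
    by (rule card_image) (auto simp: inj_on_def doubleton_eq_iff)
  ultimately show ?thesis by (simp add: inner_def)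
qed

lemma inner_four_cycle:
  assumes "distinct [a,b,c,d]" "adj a b" "adj b c" "adj c d" "adj d a"
  shows "inner {a,b,c,d} = 4 + (if adj a c then 1 else 0) + (if adj b d then 1 else 0)"
proof -
  have "{e\<in>E. e \<subseteq> {a,b,c,d}} = {{a,b},{b,c},{c,d},{d,a}}
     \<union> (if adj a c then {{a,c}} else {}) \<union> (if adj b d then {{b,d}} else {})"
  proof (intro equalityI subsetI)
    fix e assume e: "e \<in> {e\<in>E. e \<subseteq> {a,b,c,d}}"
    obtain x y where xy: "e = {x, y}" "x \<noteq> y" using edge e
      by (metis (no_types, lifting) card_2_iff mem_Collect_eq)
    then have "x \<in> {a,b,c,d}" "y \<in> {a,b,c,d}" "{x, y} \<in> E" using e by auto
    then show "e \<in> {{a,b},{b,c},{c,d},{d,a}}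
     \<union> (if adj a c then {{a,c}} else {}) \<union> (if adj b d then {{b,d}} else {})"
      using xy by (auto simp: adj_def insert_commute)
  qed (use assms in \<open>auto simp: adj_def split: if_splits\<close>)
  then show ?thesis unfolding inner_def using assms(1) by (auto simp: doubleton_eq_iff)
qed

lemma wheel_inner:
  assumes W: "wheel v a b c d"
  shows "inner {v,a,b,c,d} = 4 + inner {a,b,c,d}"
  using inner_insert_apex[of "{a,b,c,d}" v] W by (auto simp: wheel_def nb_iff)

text \<open>An edge \<open>a d\<close> would close the path to a rim, and the chords
  \<open>a c\<close> and \<open>b d\<close> together would give the rim \<open>a c d b\<close>. So
  the three path edges are joined by at most one more.\<close>

lemma fan_inner:
  assumes F: "fan v a b c d" and W: "\<not> wheel v a b c d" "\<not> wheel v a c d b"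
  shows "inner {a,b,c,d} \<le> 4"
proof -
  have "\<not> adj a d" using F W(1) by (auto simp: fan_def wheel_def adj_commute)
  moreover have "\<not> adj a c \<or> \<not> adj b d" using F W(2)
    by (auto simp: fan_def wheel_def adj_commute)
  \<comment> \<open>The only possible chord. With neither chord present, \<open>X\<close> is a
    non-edge, which does not hurt an upper bound.\<close>
  moreover define X where "X = (if adj a c then {a, c} else {b, d})"
  ultimately have X: "{x, y} \<in> {{a,b},{b,c},{c,d},X}"
    if "{x, y} \<in> E" "x \<noteq> y" "x \<in> {a,b,c,d}" "y \<in> {a,b,c,d}" for x y
    using that unfolding adj_def by (auto simp: insert_commute)
  have "{e\<in>E. e \<subseteq> {a,b,c,d}} \<subseteq> {{a,b},{b,c},{c,d},X}"
  proof
    fix e assume e: "e \<in> {e\<in>E. e \<subseteq> {a,b,c,d}}"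
    then obtain x y where "e = {x, y}" "x \<noteq> y" using edge
      by (metis (no_types, lifting) card_2_iff mem_Collect_eq)
    then show "e \<in> {{a,b},{b,c},{c,d},X}" using X[of x y] e by simp
  qed
  then have "inner {a,b,c,d} \<le> card {{a,b},{b,c},{c,d},X}"
    unfolding inner_def by (rule card_mono[rotated]) simp
  also have "\<dots> \<le> 4" by (simp add: card_insert_if)
  finally show ?thesis .
qed

text \<open>Each outside vertex sees at most two clique vertices, so the sum is at most 5 * 4 + 2 *
  (card V - 5).\<close>

lemma K5_sum_deg:
  assumes "Q \<subseteq> V" "card Q = 5" and clique: "\<And>x y. x \<in> Q \<Longrightarrow> y \<in> Q \<Longrightarrow> x \<noteq> y \<Longrightarrow> adj x y"
  shows "(\<Sum>x\<in>Q. deg x) \<le> 2 * card V + 10"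
proof -
  have fQ: "finite Q" using assms(2) by (simp add: card_ge_0_finite)
  have out: "card (nb z \<inter> Q) \<le> 2" if z: "z \<in> V - Q" for z
  proof (rule ccontr)
    assume "\<not> card (nb z \<inter> Q) \<le> 2"
    then have "3 \<le> card (nb z \<inter> Q)" by simp
    then obtain T where T: "T \<subseteq> nb z \<inter> Q" "card T = 3"
      by (rule obtain_subset_with_card_n)
    then obtain p q r where pqr: "T = {p, q, r}" "p \<noteq> q" "p \<noteq> r" "q \<noteq> r"
      by (auto simp: card_3_iff)
    have "T \<subseteq> Q" using T(1) by simp
    then have "card (Q - T) = 2" using T(2) assms(2) fQ
      by (simp add: card_Diff_subset finite_subset)
    then obtain s t where st: "Q - T = {s, t}" "s \<noteq> t" by (auto simp: card_2_iff)
    have m: "s \<in> Q" "t \<in> Q" "p \<in> Q" "q \<in> Q" "r \<in> Q" "s \<notin> {p,q,r}" "t \<notin> {p,q,r}"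
      using st(1) T(1) pqr(1) by blast+
    \<comment> \<open>The clique vertices \<open>s\<close> and \<open>t\<close> become the hub and
      the second path vertex, so that \<open>z\<close> sees exactly the positions required by
      \<open>fan_second_apex\<close>.\<close>
    then have "fan s p t q r" unfolding fan_def using st(2) pqr clique by auto
    moreover have "z \<notin> {s, p, t, q, r}" using m z by blast
    ultimately show False using fan_second_apex[of s p t q r z] T(1) pqr(1) by (auto simp: nb_iff)
  qed
  have "(\<Sum>x\<in>Q. deg x) \<le> (\<Sum>z\<in>Q. card (nb z \<inter> Q)) + 2 * (card V - card Q)"
    by (rule sum_deg_le[OF assms(1) assms(1) out])
  moreover have "card (nb z \<inter> Q) \<le> 4" if "z \<in> Q" for z
  proof -
    have "nb z \<inter> Q \<subseteq> Q - {z}" using nb_irrefl by blast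
    then have "card (nb z \<inter> Q) \<le> card (Q - {z})" using fQ by (intro card_mono) auto
    then show ?thesis using that assms(2) fQ by simp
  qed
  then have "(\<Sum>z\<in>Q. card (nb z \<inter> Q)) \<le> of_nat (card Q) * 4"
    by (rule sum_bounded_above)
  moreover have "5 \<le> card V" using card_mono[OF fin assms(1)] assms(2) by simp
  ultimately show ?thesis using assms(2) by simp
qed

section \<open>Subgraphs and small graphs\<close>

lemma prism_free_subgraph:
  assumes "W \<subseteq> V" "F \<subseteq> E" "\<And>e. e \<in> F \<Longrightarrow> e \<subseteq> W"
  shows "prism_free_graph W F"
proof
  show "finite W" using assms(1) fin by (rule finite_subset)
  show "e \<subseteq> W \<and> card e = 2" if "e \<in> F" for e
    using that assms edge by blast
qed (use assms(2) in \<open>auto intro: no_prism dest: subsetD\<close>)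

lemma edges_le_choose: "card E \<le> card V choose 2"
proof -
  have "card E \<le> card {B. B \<subseteq> V \<and> card B = 2}"
    by (rule card_mono) (use edge fin in auto)
  then show ?thesis using n_subsets[OF fin, of 2] by simp
qed

text \<open>The complement of the prism in K6 is a 6-cycle. Two missing pairs, disjoint or sharing a
  vertex, always fit into such a cycle, so 13 edges force a prism.\<close>

lemma edges_le_12:
  assumes V6: "card V = 6"
  shows "card E \<le> 12"
proof (rule ccontr)
  assume "\<not> card E \<le> 12"
  define A where "A = {B. B \<subseteq> V \<and> card B = 2}"
  have "finite A" using fin by (simp add: A_def)
  have cA: "card A = 15" unfolding A_def n_subsets[OF fin] V6 by (simp add: choose_two)
  have "E \<subseteq> A" using edge by (auto simp: A_def)
  then have "card (A - E) \<le> 2"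
    using cA \<open>\<not> card E \<le> 12\<close> finite_E by (simp add: card_Diff_subset)
  \<comment> \<open>Padding to exactly two pairs, possibly with edges among them, avoids separate
    cases for fewer missing pairs.\<close>
  then obtain N where N: "A - E \<subseteq> N" "N \<subseteq> A" "card N = 2"
    using exists_subset_between[of "A - E" 2 A] cA \<open>finite A\<close> by auto
  then obtain e1 e2 where e: "N = {e1, e2}" "e1 \<noteq> e2" by (auto simp: card_2_iff)
  have e12: "e1 \<subseteq> V" "card e1 = 2" "e2 \<subseteq> V" "card e2 = 2" using N(2) e
    by (auto simp: A_def)
  have adjI: "adj x y"
    if "x \<in> V" "y \<in> V" "x \<noteq> y" "{x, y} \<noteq> e1" "{x, y} \<noteq> e2" for x y
  proof -
    have "{x, y} \<in> A" using that by (auto simp: A_def)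
    then show ?thesis using N(1) e(1) that(4,5) by (auto simp: adj_def)
  qed
  show False
  proof (cases "e1 \<inter> e2 = {}")
    case True
    obtain a b where ab: "e1 = {a, b}" "a \<noteq> b" using e12(2) by (auto simp: card_2_iff)
    obtain c d where cd: "e2 = {c, d}" "c \<noteq> d" using e12(4) by (auto simp: card_2_iff)
    have dist: "distinct [a, b, c, d]" using True ab cd by auto
    have sub: "{a, b, c, d} \<subseteq> V" using e12 ab cd by auto
    have "card (V - {a, b, c, d}) = 2" using card_Diff_subset[OF _ sub] dist V6 by simp
    then obtain p q where pq: "V - {a, b, c, d} = {p, q}" "p \<noteq> q" by (auto simp: card_2_iff)
    then have m: "p \<in> V" "q \<in> V" "p \<notin> {a, b, c, d}" "q \<notin> {a, b, c, d}"
      by blast+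
    show False
      by (rule no_prism_adj[of a c p q b d])
        (use dist sub m pq(2) in \<open>auto intro!: adjI simp: ab cd doubleton_eq_iff\<close>)
  next
    case False
    then obtain a where a: "a \<in> e1" "a \<in> e2" by blast
    obtain b where b: "e1 = {a, b}" "a \<noteq> b" using e12(2) a(1) by (auto simp: card_2_iff)
    obtain c where c: "e2 = {a, c}" "a \<noteq> c" using e12(4) a(2) by (auto simp: card_2_iff)
    have "b \<noteq> c" using e(2) b c by auto
    have sub: "{a, b, c} \<subseteq> V" using e12 b c by auto
    have "card (V - {a, b, c}) = 3"
      using card_Diff_subset[OF _ sub] b c \<open>b \<noteq> c\<close> V6 by simp
    then obtain p q r where pqr: "V - {a, b, c} = {p, q, r}" "p \<noteq> q" "p \<noteq> r" "q \<noteq> r"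
      by (auto simp: card_3_iff)
    then have m: "p \<in> V" "q \<in> V" "r \<in> V" "p \<notin> {a, b, c}" "q \<notin> {a, b, c}" "r \<notin> {a, b, c}" by blast+
    show False
      by (rule no_prism_adj[of a p q r b c])
        (use sub m pqr(2-) b(2) c(2) \<open>b \<noteq> c\<close> in \<open>auto intro!: adjI simp: b(1) c(1) doubleton_eq_iff\<close>)
  qed
qed

end

section \<open>Minimal graphs with one edge too many\<close>

locale critical_graph = prism_free_graph +
  assumes edges: "card E = turan_prism (card V) + 1"
    and minimal: "S \<subseteq> V \<Longrightarrow> S \<noteq> {} \<Longrightarrow> card V - card S \<noteq> 5 \<Longrightarrow>
      card {e\<in>E. e \<inter> S = {}} \<le> turan_prism (card V - card S)"
begin

text \<open>Minimality bounds the last term of the left side of \<open>sum_deg_delete\<close>. Five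
  remaining vertices are excluded because K5 has ten edges while \<open>turan_prism 5\<close> is
  nine.\<close>

lemma sum_deg_ge:
  assumes "S \<subseteq> V" "S \<noteq> {}" "card V = m + card S" "m \<noteq> 5"
  shows "turan_prism (card V) + 1 + inner S \<le> (\<Sum>x\<in>S. deg x) + turan_prism m"
proof -
  have "finite S" using assms(1) fin finite_subset by blast
  then show ?thesis using sum_deg_delete[of S] minimal[of S] assms edges by simp
qed

lemma deg_ge:
  assumes "x \<in> V" "card V = m + 1" "m \<noteq> 5"
  shows "turan_prism (card V) + 1 \<le> deg x + turan_prism m"
  using sum_deg_ge[of "{x}" m] assms by simp

text \<open>An exact value, since the excess is exactly one edge; it determines the total surplus
  over the minimum degree.\<close>

lemma sum_deg_V: "(\<Sum>x\<in>V. deg x) = 2 * turan_prism (card V) + 2"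
  using handshake edges by simp

lemma min_deg_sum: "(\<And>x. x \<in> V \<Longrightarrow> d \<le> deg x) \<Longrightarrow> card V * d \<le> 2 * turan_prism (card V) + 2"
  using sum_bounded_below[of V d deg] sum_deg_V by simp

lemma adj_exists: "x \<in> V \<Longrightarrow> 0 < deg x \<Longrightarrow> \<exists>u. adj x u"
  unfolding deg_def by (metis all_not_in_conv card.empty less_irrefl nb_iff)

text \<open>Deleting one vertex gives minimum degree \<open>3 * k + 3\<close>, and
  \<open>(6 * k + 3) * (3 * k + 3)\<close> exceeds twice the number of edges. The next two residues
  work alike.\<close>

lemma not_3_mod_6: "card V \<noteq> 6 * k + 3"
proof
  assume n: "card V = 6 * k + 3"
  have "3 * k + 3 \<le> deg x" if "x \<in> V" for x
    using deg_ge[OF that, of "6 * k + 2"] unfolding n turan_prism_closed_forms by simp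
  from min_deg_sum[OF this] show False
    unfolding n turan_prism_closed_forms by (simp add: algebra_simps)
qed

lemma not_4_mod_6: "card V \<noteq> 6 * k + 4"
proof
  assume n: "card V = 6 * k + 4"
  have "3 * k + 4 \<le> deg x" if "x \<in> V" for x
    using deg_ge[OF that, of "6 * k + 3"] unfolding n turan_prism_closed_forms by simp
  from min_deg_sum[OF this] show False
    unfolding n turan_prism_closed_forms by (simp add: algebra_simps)
qed

text \<open>For \<open>k = 0\<close> both sides of the handshake inequality would be 20, as for K5;
  the contradiction needs \<open>39 * k > 36 * k\<close>.\<close>

lemma not_5_mod_6: "1 \<le> k \<Longrightarrow> card V \<noteq> 6 * k + 5"
proof
  assume "1 \<le> k" and n: "card V = 6 * k + 5"
  have "3 * k + 4 \<le> deg x" if "x \<in> V" for x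
    using deg_ge[OF that, of "6 * k + 4"] unfolding n turan_prism_closed_forms by simp
  from min_deg_sum[OF this] \<open>1 \<le> k\<close> show False
    unfolding n turan_prism_closed_forms by (simp add: algebra_simps)
qed

lemma card_triangle: "adj x y \<Longrightarrow> adj y z \<Longrightarrow> adj x z \<Longrightarrow> card {x, y, z} = 3 \<and> {x, y, z} \<subseteq> V"
  using adj_neq[of x y] adj_neq[of y z] adj_neq[of x z] adj_V[of x y] adj_V[of y z] by auto

text \<open>With \<open>k = 0\<close>, deleting a vertex would leave the exceptional five. Otherwise
  the total surplus is 2 and every triangle has surplus, so the two surplus vertices are the common
  neighbours of every edge avoiding them. This gives one of them far too large a degree.\<close>

lemma not_0_mod_6:
  assumes "1 \<le> k"
  shows "card V \<noteq> 6 * k + 6"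
proof
  assume n: "card V = 6 * k + 6"
  have d: "3 * k + 4 \<le> deg x" if "x \<in> V" for x
    using deg_ge[OF that, of "6 * k + 5"] assms unfolding n turan_prism_closed_forms by simp
  define exc where "exc x = deg x - (3 * k + 4)" for x
  have deg: "deg x = 3 * k + 4 + exc x" if "x \<in> V" for x
    using d[OF that] by (simp add: exc_def)
  have "(\<Sum>x\<in>V. deg x) = card V * (3 * k + 4) + (\<Sum>x\<in>V. exc x)"
    using deg by (simp add: sum.distrib)
  then have total: "(\<Sum>x\<in>V. exc x) = 2"
    unfolding sum_deg_V n turan_prism_closed_forms by (simp add: algebra_simps)
  have tri: "1 \<le> exc x + exc y + exc z" if t: "adj x y" "adj y z" "adj x z" for x y z
    using sum_deg_ge[of "{x,y,z}" "6 * k + 3"] card_triangle[OF t] inner_triangle[OF t] adj_neq[OF t(1)] adj_neq[OF t(2)]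
      adj_neq[OF t(3)] deg[of x] deg[of y] deg[of z]
    unfolding n turan_prism_closed_forms by simp
  \<comment> \<open>\<open>p\<close> and \<open>q\<close> are the two vertices of positive surplus,
    hence of surplus one each.\<close>
  obtain p q where pq: "p \<in> V" "\<And>x y. adj x y \<Longrightarrow> x \<notin> {p,q} \<Longrightarrow> y \<notin> {p,q} \<Longrightarrow> p \<in> nb x" "exc p \<le> 1"
  proof -
    define X where "X = {x\<in>V. 1 \<le> exc x}"
    have X: "X \<subseteq> V" "finite X" using fin by (auto simp: X_def)
    have "(\<Sum>x\<in>X. exc x) \<le> 2" using total sum_mono2[OF fin X(1), of exc] by simp
    moreover have "card X \<le> (\<Sum>x\<in>X. exc x)" using sum_mono[of X "\<lambda>_. 1" exc]
      by (simp add: X_def)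
    ultimately have cX: "card X \<le> 2" by simp
    have nbX: "nb x \<inter> nb y = X \<and> card X = 2" if "adj x y" "x \<notin> X" "y \<notin> X"
      for x y
    proof -
      have xy: "exc x = 0" "exc y = 0" using that adj_V by (auto simp: X_def)
      have "nb x \<inter> nb y \<subseteq> X"
      proof
        fix z assume "z \<in> nb x \<inter> nb y"
        then show "z \<in> X" using tri[of x y z] that xy adj_V by (auto simp: X_def nb_iff)
      qed
      moreover have "2 \<le> card (nb x \<inter> nb y)"
        using codegree[of x y] deg[of x] deg[of y] adj_V that by (auto simp: n xy)
      ultimately show ?thesis using cX X(2) by (metis card_mono card_seteq le_antisym order_trans)
    qed
    \<comment> \<open>Degrees exceed 2, so some edge avoids \<open>X\<close>; its common neighbours
      show that \<open>X\<close> has two elements.\<close>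
    have "\<not> V \<subseteq> X" using card_mono[OF X(2), of V] cX n assms by auto
    then obtain y where y: "y \<in> V" "y \<notin> X" by blast
    have "\<not> nb y \<subseteq> X" using card_mono[OF X(2), of "nb y"] cX d[OF y(1)]
      by (auto simp: deg_def)
    then obtain z where "adj y z" "z \<notin> X" using nb_iff by blast
    then have c2: "card X = 2" using nbX y by blast
    then obtain p q where XX: "X = {p, q}" "p \<noteq> q" by (auto simp: card_2_iff)
    have "1 \<le> exc q" "p \<in> V" using XX(1) by (auto simp: X_def)
    moreover have "exc p + exc q \<le> 2" using \<open>(\<Sum>x\<in>X. exc x) \<le> 2\<close> XX
      by simp
    ultimately show thesis using that[of p q] nbX XX by auto
  qed
  \<comment> \<open>Every such vertex lies on an edge avoiding \<open>p\<close> and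
    \<open>q\<close>. Then \<open>p\<close> has degree at least \<open>6 * k + 4\<close>, more than
    \<open>3 * k + 5\<close>.\<close>
  have "V - {p, q} \<subseteq> nb p"
  proof
    fix y assume y: "y \<in> V - {p, q}"
    have "card {p, q} \<le> 2" by (simp add: card_insert_if)
    then have "\<not> nb y \<subseteq> {p, q}" using card_mono[of "{p,q}" "nb y"] d[of y] y
      by (auto simp: deg_def)
    then obtain z where "adj y z" "z \<notin> {p, q}" using nb_iff by blast
    then show "y \<in> nb p" using pq(2)[of y z] y by (auto simp: nb_iff adj_commute)
  qed
  then have "card (V - {p, q}) \<le> deg p" unfolding deg_def by (rule card_mono[OF finite_nb])
  moreover have "card V - card {p, q} \<le> card (V - {p, q})" by (rule diff_card_le_card_Diff) simp
  moreover have "card {p, q} \<le> 2" by (simp add: card_insert_if)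
  ultimately show False using deg[OF pq(1)] pq(3) assms n by simp
qed

text \<open>The total surplus grows with \<open>k\<close>, so it is traded against inner edges:
  first wheels with a chord are excluded, then all wheels, then fans. A vertex of positive surplus
  finishes the argument.\<close>

lemma not_1_mod_6: "card V \<noteq> 6 * k + 7"
proof
  assume n: "card V = 6 * k + 7"
  have d: "3 * k + 4 \<le> deg x" if "x \<in> V" for x
    using deg_ge[OF that, of "6 * k + 6"] unfolding n turan_prism_closed_forms by simp
  define exc where "exc x = deg x - (3 * k + 4)" for x
  have deg: "deg x = 3 * k + 4 + exc x" if "x \<in> V" for x
    using d[OF that] by (simp add: exc_def)
  have "(\<Sum>x\<in>V. deg x) = card V * (3 * k + 4) + (\<Sum>x\<in>V. exc x)"
    using deg by (simp add: sum.distrib)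
  then have total: "(\<Sum>x\<in>V. exc x) = 3 * k + 4"
    unfolding sum_deg_V n turan_prism_closed_forms by (simp add: algebra_simps)
  have tri: "1 \<le> exc x + exc y + exc z" if t: "adj x y" "adj y z" "adj x z" for x y z
    using sum_deg_ge[of "{x,y,z}" "6 * k + 4"] card_triangle[OF t] inner_triangle[OF t] adj_neq[OF t(1)] adj_neq[OF t(2)]
      adj_neq[OF t(3)] deg[of x] deg[of y] deg[of z]
    unfolding n turan_prism_closed_forms by simp
  have four: "inner {a,b,c,d} \<le> exc a + exc b + exc c + exc d + 3"
    if "distinct [a,b,c,d]" "{a,b,c,d} \<subseteq> V" for a b c d
    using sum_deg_ge[of "{a,b,c,d}" "6 * k + 3"] that deg[of a] deg[of b] deg[of c] deg[of d]
    unfolding n turan_prism_closed_forms by simp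
  have five: "inner {v,a,b,c,d} \<le> exc v + exc a + exc b + exc c + exc d + 5"
    if "distinct [v,a,b,c,d]" "{v,a,b,c,d} \<subseteq> V" for v a b c d
    using sum_deg_ge[of "{v,a,b,c,d}" "6 * k + 2"] that deg[of a] deg[of b] deg[of c] deg[of d] deg[of v]
    unfolding n turan_prism_closed_forms by simp
  have codeg: "1 + exc x + exc y \<le> card (nb x \<inter> nb y)" if "adj x y" for x y
    using codegree[of x y] deg[of x] deg[of y] adj_V that by (auto simp: n)
  have rim: "exc a + exc b + exc c + exc d + 16 \<le> 2 * inner {v,a,b,c,d}"
    if W: "wheel v a b c d" for v a b c d
  proof -
    have "{a,b,c,d} \<subseteq> V" "distinct [a,b,c,d]" using W adj_V by (auto simp: wheel_def)
    then show ?thesis using wheel_sum_deg[OF W] wheel_inner[OF W] deg by (simp add: n)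
  qed
  have no_chord: "\<not> adj a c" if W: "wheel v a b c d" for v a b c d
  proof
    assume ac: "adj a c"
    have V: "{v,a,b,c,d} \<subseteq> V" "card {v,a,b,c,d} = 5" "distinct [v,a,b,c,d]"
      using W adj_V by (auto simp: wheel_def)
    have i4: "inner {a,b,c,d} = 5 + (if adj b d then 1 else 0)"
      using inner_four_cycle[of a b c d] W ac by (simp add: wheel_def)
    show False
    proof (cases "adj b d")
      case True
      \<comment> \<open>In a K5, \<open>five\<close> gives surplus at least 5, hence degree sum at
        least \<open>15 * k + 25\<close>, against \<open>12 * k + 24\<close> from
        \<open>K5_sum_deg\<close>.\<close>
      have "adj x y" if "x \<in> {v,a,b,c,d}" "y \<in> {v,a,b,c,d}" "x \<noteq> y" for x y
        using that W ac True by (auto simp: wheel_def adj_commute)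
      from K5_sum_deg[OF V(1,2) this] five[OF V(3,1)] i4 wheel_inner[OF W] True V deg
      show False by (simp add: n)
    next
      case False
      \<comment> \<open>In K5 without \<open>b d\<close>, the nine edges demand total surplus at
        least 4. Each of \<open>v\<close>, \<open>a\<close>, \<open>c\<close> is a hub, whose rim
        has surplus at most 2; the three rims cover each vertex at least twice, so the total is at
        most 3.\<close>
      have "wheel a v b c d" "wheel c v b a d"
        using W ac by (auto simp: wheel_def adj_commute)
      moreover have "{a,v,b,c,d} = {v,a,b,c,d}" "{c,v,b,a,d} = {v,a,b,c,d}" by auto
      ultimately show False
        using rim[OF W] rim[of a v b c d] rim[of c v b a d] five[OF V(3,1)] i4 wheel_inner[OF W] False
        by simp
    qed
  qed
  have no_wheel: "\<not> wheel v a b c d" for v a b c d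
  proof
    assume W: "wheel v a b c d"
    then have V: "{a,b,c,d} \<subseteq> V" "distinct [a,b,c,d]" using adj_V
      by (auto simp: wheel_def)
    have "\<not> adj a c" "\<not> adj b d" using no_chord[OF W] no_chord[OF wheel_rotate[OF W]] .
    then have "inner {a,b,c,d} = 4" using inner_four_cycle[of a b c d] W by (simp add: wheel_def)
    \<comment> \<open>Eight inner edges leave no surplus on the rim by \<open>rim\<close>, and then
      \<open>four\<close> permits only three rim edges.\<close>
    then show False using rim[OF W] wheel_inner[OF W] four[OF V(2,1)] by simp
  qed
  have no_fan: "\<not> fan v a b c d" for v a b c d
  proof
    assume F: "fan v a b c d"
    then have V: "{a,b,c,d} \<subseteq> V" "distinct [a,b,c,d]" using adj_V by (auto simp: fan_def)
    show False
      using fan_sum_deg[OF F no_wheel] fan_inner[OF F no_wheel no_wheel] four[OF V(2,1)] V deg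
      by (simp add: n)
  qed
  \<comment> \<open>Edges at \<open>x\<close> have codegree at least 2, and exactly 2 by
    \<open>no_fan_K4\<close>; so the neighbours of \<open>x\<close> have no surplus, and a triangle
    among them contradicts \<open>tri\<close>.\<close>
  obtain x where x: "x \<in> V" "1 \<le> exc x"
    using total
      by (metis One_nat_def add_is_0 not_less_eq_eq le_zero_eq sum.neutral zero_neq_numeral)
  have codeg2: "2 \<le> card (nb x \<inter> nb u)" if "adj x u" for u
    using codeg[OF that] x(2) by simp
  have exc0: "exc u = 0" if xu: "adj x u" for u
  proof -
    obtain c e where "c \<noteq> e" "nb x \<inter> nb u = {c, e}"
      using no_fan_K4[OF no_fan codeg2 xu] by metis
    then show ?thesis using codeg[OF xu] x(2) by simp
  qed
  obtain u where xu: "adj x u" using adj_exists[OF x(1)] deg[OF x(1)] by auto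
  obtain c e where K: "adj u c" "adj u e" "adj c e" "nb x \<inter> nb u = {c, e}"
    using no_fan_K4[OF no_fan codeg2 xu] by metis
  have "adj x c" "adj x e" using K(4) by (auto simp: nb_iff)
  then show False using tri[OF K(1,3,2)] exc0 xu by simp
qed

text \<open>The minimum degree already exhausts the degree sum, so the graph is regular. Without
  wheels and fans every edge lies in a K4, and an outside vertex sees at most one of its vertices:
  \<open>12 * k + 20\<close> edge ends face at most \<open>4 * 3 + (6 * k + 4)\<close>.\<close>

lemma not_2_mod_6: "card V \<noteq> 6 * k + 8"
proof
  assume n: "card V = 6 * k + 8"
  have d: "3 * k + 5 \<le> deg x" if "x \<in> V" for x
    using deg_ge[OF that, of "6 * k + 7"] unfolding n turan_prism_closed_forms by simp
  have deg: "deg x = 3 * k + 5" if "x \<in> V" for x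
  proof (rule ccontr)
    assume "deg x \<noteq> 3 * k + 5"
    then have "3 * k + 5 < deg x" using d[OF that] by simp
    then have "(\<Sum>x\<in>V. 3 * k + 5) < (\<Sum>x\<in>V. deg x)"
      by (intro sum_strict_mono_ex1[OF fin]) (use d that in auto)
    then show False unfolding sum_deg_V n turan_prism_closed_forms by (simp add: n algebra_simps)
  qed
  have codeg: "2 \<le> card (nb x \<inter> nb y)" if "adj x y" for x y
    using codegree[of x y] deg[of x] deg[of y] adj_V that by (auto simp: n)
  have no_wheel: "\<not> wheel v a b c d" for v a b c d
  proof
    assume W: "wheel v a b c d"
    then have V: "{v,a,b,c,d} \<subseteq> V" "card {v,a,b,c,d} = 5" "distinct [v,a,b,c,d]"
      using adj_V by (auto simp: wheel_def)
    have "inner {v,a,b,c,d} \<le> 8"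
      using sum_deg_ge[OF V(1), of "6 * k + 3"] V deg
      unfolding n turan_prism_closed_forms by simp
    then show False
      using wheel_sum_deg[OF W] wheel_inner[OF W] V deg by (simp add: n)
  qed
  have no_fan: "\<not> fan v a b c d" for v a b c d
  proof
    assume F: "fan v a b c d"
    then have V: "{v,a,b,c,d} \<subseteq> V" "distinct [v,a,b,c,d]" using adj_V
      by (auto simp: fan_def)
    show False
      using fan_sum_deg[OF F no_wheel] fan_inner[OF F no_wheel no_wheel] V deg by (simp add: n)
  qed
  obtain x where x: "x \<in> V" using n by fastforce
  obtain u where xu: "adj x u" using adj_exists[OF x] deg[OF x] by auto
  obtain c e where K: "c \<noteq> e" "adj u c" "adj u e" "adj c e" "nb x \<inter> nb u = {c, e}"
    using no_fan_K4[OF no_fan codeg xu] by metis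
  have xce: "adj x c" "adj x e" using K(5) by (auto simp: nb_iff)
  show False
  proof -
    have dist: "distinct [x, u, c, e]"
      using K(1) adj_neq[OF xu] adj_neq[OF K(2)] adj_neq[OF K(3)] adj_neq[OF xce(1)] adj_neq[OF xce(2)] by auto
    have sub: "{x, u, c, e} \<subseteq> V" using adj_V[OF xu] adj_V[OF xce(1)] adj_V[OF xce(2)]
      by auto
    have out: "card (nb z \<inter> {x, u, c, e}) \<le> 1" if z: "z \<in> V - {x, u, c, e}" for z
    proof (rule ccontr)
      assume "\<not> card (nb z \<inter> {x, u, c, e}) \<le> 1"
      then obtain p q where pq: "p \<noteq> q" "p \<in> nb z \<inter> {x, u, c, e}" "q \<in> nb z \<inter> {x, u, c, e}"
        using card_le_Suc0_iff_eq[of "nb z \<inter> {x, u, c, e}"] by auto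
      have "card ({x, u, c, e} - {p, q}) = 2" using pq dist by auto
      then obtain r s where rs: "{x, u, c, e} - {p, q} = {r, s}" "r \<noteq> s"
        by (auto simp: card_2_iff)
      have clique: "adj i j" if "i \<in> {x,u,c,e}" "j \<in> {x,u,c,e}" "i \<noteq> j" for i j
        using that K(2,3,4) xu xce by (auto simp: adj_commute)
      have m: "r \<in> {x,u,c,e}" "s \<in> {x,u,c,e}" "r \<noteq> p" "r \<noteq> q" "s \<noteq> p" "s \<noteq> q" using rs by auto
      \<comment> \<open>In the neighbourhood of \<open>p\<close>, the vertex \<open>z\<close>
        prolongs the path \<open>q r s\<close>.\<close>
      have "fan p z q r s"
        unfolding fan_def
          using m rs(2) pq z clique[of p q] clique[of p r] clique[of p s] clique[of q r] clique[of r s]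
        by (auto simp: nb_iff adj_commute)
      then show False using no_fan by blast
    qed
    have "(\<Sum>p\<in>{x,u,c,e}. deg p) \<le> (\<Sum>z\<in>{x,u,c,e}. card (nb z \<inter> {x,u,c,e})) + 1 * (card V - card {x,u,c,e})"
      using sum_deg_le[OF sub sub out] .
    moreover have "card (nb z \<inter> {x,u,c,e}) \<le> 3" if "z \<in> {x,u,c,e}" for z
    proof -
      have "nb z \<inter> {x,u,c,e} \<subseteq> {x,u,c,e} - {z}" using nb_irrefl by blast
      then have "card (nb z \<inter> {x,u,c,e}) \<le> card ({x,u,c,e} - {z})"
        by (rule card_mono[rotated]) simp
      also have "\<dots> = 3" using that dist by auto
      finally show ?thesis .
    qed
    then have "(\<Sum>z\<in>{x,u,c,e}. card (nb z \<inter> {x,u,c,e})) \<le> of_nat (card {x,u,c,e}) * 3"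
      by (rule sum_bounded_above)
    ultimately show False using dist deg sub by (simp add: n)
  qed
qed

lemma card_V_le_6: "card V \<le> 6"
proof (rule ccontr)
  assume "\<not> card V \<le> 6"
  then obtain m where m: "card V = 7 + m" using le_Suc_ex[of 7 "card V"] by auto
  define k r where "k = m div 6" and "r = m mod 6"
  then have "m = 6 * k + r" "r < 6" by auto
  \<comment> \<open>Residues 1 and 2 start at 7 and 8; the others use \<open>k + 1\<close>, which
    supplies the condition \<open>1 \<le> k\<close> where it is required.\<close>
  then have "card V = 6 * k + 7 \<or> card V = 6 * k + 8 \<or> card V = 6 * (k + 1) + 3
    \<or> card V = 6 * (k + 1) + 4 \<or> card V = 6 * (k + 1) + 5 \<or> card V = 6 * (k + 1) + 6"
    using m by auto
  then show False
    using not_0_mod_6[of "k + 1"] not_1_mod_6[of k] not_2_mod_6[of k] not_3_mod_6[of "k + 1"]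
      not_4_mod_6[of "k + 1"] not_5_mod_6[of "k + 1"] by auto
qed

end

section \<open>The upper bound\<close>

lemma prism_free_edges_le:
  assumes "prism_free_graph V E" "card V \<noteq> 5"
  shows "card E \<le> turan_prism (card V)"
  using assms
proof (induction "card V" arbitrary: V E rule: less_induct)
  case less
  show ?case
  proof (rule ccontr)
    interpret prism_free_graph V E by fact
    assume "\<not> card E \<le> turan_prism (card V)"
    then have "turan_prism (card V) + 1 \<le> card E" by simp
    \<comment> \<open>Further edges are discarded, since \<open>critical_graph\<close> asks for
      exactly one too many.\<close>
    then obtain F where F: "F \<subseteq> E" "card F = turan_prism (card V) + 1"
      by (rule obtain_subset_with_card_n)
    interpret F: prism_free_graph V F
      using F(1) edge by (intro prism_free_subgraph) auto
    interpret F: critical_graph V F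
    proof
      show "card F = turan_prism (card V) + 1" by fact
      fix S assume S: "S \<subseteq> V" "S \<noteq> {}" "card V - card S \<noteq> 5"
      have finS: "finite S" using S(1) fin finite_subset by blast
      then have c: "card (V - S) = card V - card S" using S(1) by (simp add: card_Diff_subset)
      have "0 < card S" using finS S(2) by (simp add: card_gt_0_iff)
      moreover have "card S \<le> card V" using card_mono[OF fin S(1)] .
      ultimately have "card (V - S) < card V" using c by simp
      moreover have "prism_free_graph (V - S) {e \<in> F. e \<inter> S = {}}"
        using F.edge by (intro F.prism_free_subgraph) blast+
      ultimately show "card {e \<in> F. e \<inter> S = {}} \<le> turan_prism (card V - card S)"
        using less.hyps[of "V - S" "{e \<in> F. e \<inter> S = {}}"] S(3) c by simp
    qed
    \<comment> \<open>Up to four vertices the bound is the number of all pairs; six vertices are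
      covered by \<open>edges_le_12\<close>.\<close>
    have "card V = 0 \<or> card V = 1 \<or> card V = 2 \<or> card V = 3 \<or> card V = 4 \<or> card V = 6"
      using F.card_V_le_6 less.prems(2) by linarith
    then show False
      using F.edges_le_choose F.edges_le_12 F(2) by (auto simp: turan_prism_def choose_two)
  qed
qed

section \<open>Prisms as subgraphs\<close>

lemma contains_copy_prismI:
  assumes G: "simple_graph G" and dist: "distinct [u1, u2, u3, w1, w2, w3]"
    and e: "{u1, u2} \<in> edges G" "{u2, u3} \<in> edges G" "{u1, u3} \<in> edges G"
      "{w1, w2} \<in> edges G" "{w2, w3} \<in> edges G" "{w1, w3} \<in> edges G"
      "{u1, w1} \<in> edges G" "{u2, w2} \<in> edges G" "{u3, w3} \<in> edges G"
  shows "contains_copy G prism"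
proof -
  define H where "H = Graph {u1,u2,u3,w1,w2,w3} {{u1,u2},{u2,u3},{u1,u3},{w1,w2},{w2,w3},{w1,w3},
    {u1,w1},{u2,w2},{u3,w3}}"
  define f where "f x = (if x = u1 then (1, False) else if x = u2 then (2, False)
    else if x = u3 then (3, False) else if x = w1 then (1, True) else if x = w2 then (2, True)
    else (3::nat, True))" for x
  have f: "f u1 = (1, False)" "f u2 = (2, False)" "f u3 = (3, False)"
    "f w1 = (1, True)" "f w2 = (2, True)" "f w3 = (3, True)"
    using dist by (auto simp: f_def)
  have sub: "\<And>x y. {x, y} \<in> edges G \<Longrightarrow> x \<in> verts G \<and> y \<in> verts G"
    using G by (auto simp: simple_graph_def)
  have "simple_graph H" unfolding simple_graph_def H_def using dist by auto
  then have "subgraph H G"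
    unfolding subgraph_def using G e sub[OF e(1)] sub[OF e(2)] sub[OF e(4)] sub[OF e(5)]
    by (simp add: H_def)
  moreover have "isomorphic H prism"
    unfolding isomorphic_def
  proof (intro exI conjI)
    have "inj_on f (verts H)" unfolding inj_on_def by (simp add: H_def f)
    moreover have "f ` verts H = verts prism" by (auto simp: H_def f prism_def)
    ultimately show "bij_betw f (verts H) (verts prism)" by (simp add: bij_betw_def)
    show "edges prism = (\<lambda>e. f ` e) ` edges H" by (simp add: H_def f prism_def)
  qed
  ultimately show ?thesis by (auto simp: contains_copy_def)
qed

lemma contains_copy_prismE:
  assumes "contains_copy G prism"
  obtains u1 u2 u3 w1 w2 w3 where "distinct [u1, u2, u3, w1, w2, w3]"
    "{u1, u2} \<in> edges G" "{u2, u3} \<in> edges G" "{u1, u3} \<in> edges G"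
    "{w1, w2} \<in> edges G" "{w2, w3} \<in> edges G" "{w1, w3} \<in> edges G"
    "{u1, w1} \<in> edges G" "{u2, w2} \<in> edges G" "{u3, w3} \<in> edges G"
proof -
  obtain H f where H: "subgraph H G" and f: "bij_betw f (verts H) (verts prism)"
    and E: "edges prism = (\<lambda>e. f ` e) ` edges H"
    using assms by (auto simp: contains_copy_def isomorphic_def)
  \<comment> \<open>The inverse of the isomorphism carries the edges of \<open>prism\<close> back
    into \<open>G\<close>.\<close>
  define g where "g = the_inv_into (verts H) f"
  have inj: "inj_on f (verts H)" and im: "f ` verts H = verts prism"
    using f by (auto simp: bij_betw_def)
  have g: "{g p, g q} \<in> edges G" if pq: "{p, q} \<in> edges prism" for p q
  proof -
    obtain e where e: "e \<in> edges H" "f ` e = {p, q}" using pq E by auto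
    have "e \<subseteq> verts H" using H e(1) by (auto simp: subgraph_def simple_graph_def)
    then have "g ` f ` e = e"
      using the_inv_into_f_f[OF inj] by (force simp: g_def image_image)
    then have "e = {g p, g q}" using e(2) by simp
    then show ?thesis using H e(1) by (auto simp: subgraph_def)
  qed
  have inj_g: "inj_on g (verts prism)"
    unfolding g_def using inj_on_the_inv_into[OF inj] im by simp
  show thesis
  proof (rule that[of "g (1, False)" "g (2, False)" "g (3, False)" "g (1, True)" "g (2, True)" "g (3, True)"])
    show "distinct [g (1, False), g (2, False), g (3, False), g (1, True), g (2, True), g (3, True)]"
      by (simp add: inj_on_eq_iff[OF inj_g] prism_def)
  qed (rule g, simp add: prism_def)+
qed

lemma prism_free_graph_iff:
  assumes "simple_graph G"
  shows "prism_free_graph (verts G) (edges G) \<longleftrightarrow> \<not> contains_copy G prism"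
proof
  assume "prism_free_graph (verts G) (edges G)"
  then interpret prism_free_graph "verts G" "edges G" .
  show "\<not> contains_copy G prism"
    using no_prism by (blast elim: contains_copy_prismE)
next
  assume free: "\<not> contains_copy G prism"
  show "prism_free_graph (verts G) (edges G)"
  proof
    show "finite (verts G)" using assms by (simp add: simple_graph_def)
    show "e \<subseteq> verts G \<and> card e = 2" if "e \<in> edges G" for e
      using assms that by (simp add: simple_graph_def)
  qed (use free contains_copy_prismI[OF assms] in blast)
qed

section \<open>The extremal graphs\<close>

definition cross_edges :: "nat \<Rightarrow> nat \<Rightarrow> nat set set" where
  "cross_edges a n = (\<lambda>(x, y). {x, y}) ` ({..<a} \<times> {a..<n})"

text \<open>Consecutive numbering makes two vertices share a triangle exactly if their quotients by
  3 agree, for vertices below \<open>3 * t\<close>.\<close>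

definition triangle_edges :: "nat \<Rightarrow> nat set set" where
  "triangle_edges t = (\<Union>i<t. {{3*i, 3*i+1}, {3*i+1, 3*i+2}, {3*i, 3*i+2}})"

definition extremal_graph :: "nat \<Rightarrow> nat \<Rightarrow> nat \<Rightarrow> nat sgraph" where
  "extremal_graph a t n = Graph {..<n} (cross_edges a n \<union> triangle_edges t)"

lemma card_cross_edges: "card (cross_edges a n) = a * (n - a)"
proof -
  have "inj_on (\<lambda>(x, y). {x, y}) ({..<a} \<times> {a..<n})"
    by (auto simp: inj_on_def doubleton_eq_iff)
  then show ?thesis by (simp add: cross_edges_def card_image card_cartesian_product)
qed

lemma div3: "(3 * i) div 3 = i" "Suc (3 * i) div 3 = i" "Suc (Suc (3 * i)) div 3 = i" for i :: nat
  by presburger+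

lemma card_triangle_edges: "card (triangle_edges t) = 3 * t"
proof -
  have "card (triangle_edges t) = (\<Sum>i<t. card {{3*i, 3*i+1}, {3*i+1, 3*i+2}, {3*i, 3*i+2}})"
    unfolding triangle_edges_def
  proof (rule card_UN_disjoint)
    show "\<forall>i\<in>{..<t}. \<forall>j\<in>{..<t}. i \<noteq> j \<longrightarrow>
      {{3*i, 3*i+1}, {3*i+1, 3*i+2}, {3*i, 3*i+2}} \<inter> {{3*j, 3*j+1}, {3*j+1, 3*j+2}, {3*j, 3*j+2}} = {}"
    proof (intro ballI impI)
      fix i j :: nat assume "i \<noteq> j"
      have D: "x div 3 = i" if "e \<in> {{3*i, 3*i+1}, {3*i+1, 3*i+2}, {3*i, 3*i+2}}" "x \<in> e"
        for e :: "nat set" and x i :: nat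
        using that div3[of i] by auto
      show "{{3*i, 3*i+1}, {3*i+1, 3*i+2}, {3*i, 3*i+2}} \<inter> {{3*j, 3*j+1}, {3*j+1, 3*j+2}, {3*j, 3*j+2}} = {}"
      proof (rule ccontr)
        assume "\<not> ?thesis"
        then obtain e where e: "e \<in> {{3*i, 3*i+1}, {3*i+1, 3*i+2}, {3*i, 3*i+2}}"
          "e \<in> {{3*j, 3*j+1}, {3*j+1, 3*j+2}, {3*j, 3*j+2}}" by blast
        obtain x where "x \<in> e" using e(1) by blast
        then show False using D[OF e(1)] D[OF e(2)] \<open>i \<noteq> j\<close> by simp
      qed
    qed
  qed auto
  also have "\<dots> = (\<Sum>i<t. 3)"
    by (rule sum.cong) (auto simp: doubleton_eq_iff)
  finally show ?thesis by simp
qed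

lemma triangle_edges_div:
  assumes "e \<in> triangle_edges t" "x \<in> e" "y \<in> e"
  shows "x div 3 = y div 3" "x < 3 * t"
  using assms by (auto simp: triangle_edges_def div3)

lemma card_extremal_graph:
  assumes "3 * t \<le> a"
  shows "card (edges (extremal_graph a t n)) = a * (n - a) + 3 * t"
proof -
  have "cross_edges a n \<inter> triangle_edges t = {}"
    using triangle_edges_div(2) assms by (fastforce simp: cross_edges_def)
  moreover have "finite (cross_edges a n)" "finite (triangle_edges t)"
    by (simp_all add: cross_edges_def triangle_edges_def)
  ultimately show ?thesis
    by (simp add: extremal_graph_def card_Un_disjoint card_cross_edges card_triangle_edges)
qed

lemma simple_extremal_graph:
  assumes "3 * t \<le> a" "a \<le> n"
  shows "simple_graph (extremal_graph a t n)"
proof -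
  have "e \<subseteq> {..<n} \<and> card e = 2" if "e \<in> cross_edges a n" for e
    using that assms by (auto simp: cross_edges_def)
  moreover have "e \<subseteq> {..<n} \<and> card e = 2" if "e \<in> triangle_edges t" for e
    using that assms by (auto simp: triangle_edges_def)
  ultimately show ?thesis by (auto simp: simple_graph_def extremal_graph_def)
qed

text \<open>Two facts in one: no edge lies inside the second part, and an edge inside the first part
  stays within one block of three.\<close>

lemma extremal_graph_adj:
  assumes "{x, y} \<in> edges (extremal_graph a t n)" "3 * t \<le> a"
    and not_same: "\<not> (x < a \<and> y < a \<and> x div 3 = y div 3)"
  shows "x < a \<longleftrightarrow> \<not> y < a"
proof -
  from assms(1) consider "{x, y} \<in> cross_edges a n" | "{x, y} \<in> triangle_edges t"
    by (auto simp: extremal_graph_def)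
  then show ?thesis
  proof cases
    case 1
    then show ?thesis by (auto simp: cross_edges_def doubleton_eq_iff)
  next
    case 2
    then show ?thesis
      using triangle_edges_div[OF 2, of x y] triangle_edges_div(2)[OF 2, of y] not_same assms(2)
        by auto
  qed
qed

text \<open>
  The four vertices of a prism outside an independent pair \<open>u\<^sub>i\<close>, \<open>w\<^sub>j\<close> form a path, and a path
  inside the first part stays in one triangle.
\<close>

lemma extremal_graph_prism_free:
  assumes ta: "3 * t \<le> a"
  shows "\<not> contains_copy (extremal_graph a t n) prism"
proof
  let ?E = "edges (extremal_graph a t n)"
  assume "contains_copy (extremal_graph a t n) prism"
  then obtain u1 u2 u3 w1 w2 w3 where dist: "distinct [u1, u2, u3, w1, w2, w3]"
    and E: "{u1, u2} \<in> ?E" "{u2, u3} \<in> ?E" "{u1, u3} \<in> ?E" "{w1, w2} \<in> ?E" "{w2, w3} \<in> ?E"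
      "{w1, w3} \<in> ?E" "{u1, w1} \<in> ?E" "{u2, w2} \<in> ?E" "{u3, w3} \<in> ?E"
    by (rule contains_copy_prismE)
  have cover: "x < a \<or> y < a" if "{x, y} \<in> ?E" for x y
    using extremal_graph_adj[OF that ta] by blast
  have path: "\<not> (p < a \<and> q < a \<and> r < a \<and> s < a)"
    if "distinct [p, q, r, s]" "{p, q} \<in> ?E" "{q, r} \<in> ?E" "{r, s} \<in> ?E" for p q r s
  proof
    assume "p < a \<and> q < a \<and> r < a \<and> s < a"
    then have same: "p div 3 = q div 3" "q div 3 = r div 3" "r div 3 = s div 3"
      using extremal_graph_adj[OF that(2) ta] extremal_graph_adj[OF that(3) ta]
        extremal_graph_adj[OF that(4) ta] by blast+
    have I: "x \<in> {3 * m..<3 * m + 3}" if "x div 3 = m" for x m :: nat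
      using that by auto
    have "{p, q, r, s} \<subseteq> {3 * (p div 3)..<3 * (p div 3) + 3}"
      using I[of p "p div 3"] I[of q "p div 3"] I[of r "p div 3"] I[of s "p div 3"] same by simp
    from card_mono[OF _ this] have "card {p, q, r, s} \<le> 3" by simp
    then show False using that(1) by simp
  qed
  have E': "{u2, u1} \<in> ?E" "{u3, u2} \<in> ?E" "{u3, u1} \<in> ?E" "{w2, w1} \<in> ?E" "{w3, w2} \<in> ?E" "{w3, w1} \<in> ?E"
    using E by (simp_all add: insert_commute)
  have "\<not> (u1 < a \<and> u2 < a \<and> w2 < a \<and> w3 < a)" "\<not> (u2 < a \<and> u1 < a \<and> w1 < a \<and> w3 < a)"
    "\<not> (u1 < a \<and> u3 < a \<and> w3 < a \<and> w2 < a)" "\<not> (u3 < a \<and> u1 < a \<and> w1 < a \<and> w2 < a)"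
    "\<not> (u2 < a \<and> u3 < a \<and> w3 < a \<and> w1 < a)" "\<not> (u3 < a \<and> u2 < a \<and> w2 < a \<and> w1 < a)"
    by (rule path; use dist E E' in auto)+
  \<comment> \<open>By \<open>cover\<close>, the vertices beyond the first part lie in some pair
    \<open>u_i\<close>, \<open>w_j\<close> with distinct indices; each of the six such pairs has its
    complementary path above.\<close>
  then show False
    using cover[OF E(1)] cover[OF E(2)] cover[OF E(3)] cover[OF E(4)] cover[OF E(5)] cover[OF E(6)]
      cover[OF E(7)] cover[OF E(8)] cover[OF E(9)] by argo
qed

text \<open>For residue 3, parts of sizes 3k+3 and 3k lose two cross edges against the balanced ones
  but fit another triangle, a net gain of one. For residue 4 the same first part gains two.\<close>

lemma extremal_parameters:
  obtains a t where "3 * t \<le> a" "a \<le> n" "a * (n - a) + 3 * t = turan_prism n"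
proof -
  define k r where "k = n div 6" and "r = n mod 6"
  have "n = 6 * k + r" "r < 6" by (auto simp: k_def r_def)
  then consider "n = 6 * k" | "n = 6 * k + 1" | "n = 6 * k + 2" | "n = 6 * k + 3" | "n = 6 * k + 4"
    | "n = 6 * k + 5" by linarith
  then show thesis
  proof cases
    case 1
    show ?thesis
      \<comment> \<open>The instantiation order is \<open>t\<close>, then \<open>a\<close>.\<close>
      by (rule that[of k "3 * k"])
        (unfold 1 turan_prism_closed_forms, simp_all add: algebra_simps)
  next
    case 2
    show ?thesis
      by (rule that[of k "3 * k"])
        (unfold 2 turan_prism_closed_forms, simp_all add: algebra_simps)
  next
    case 3
    show ?thesis
      by (rule that[of k "3 * k + 1"])
        (unfold 3 turan_prism_closed_forms, simp_all add: algebra_simps)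
  next
    case 4
    show ?thesis
      by (rule that[of "k + 1" "3 * k + 3"])
        (unfold 4 turan_prism_closed_forms, simp_all add: algebra_simps)
  next
    case 5
    show ?thesis
      by (rule that[of "k + 1" "3 * k + 3"])
        (unfold 5 turan_prism_closed_forms, simp_all add: algebra_simps)
  next
    case 6
    show ?thesis
      by (rule that[of "k + 1" "3 * k + 3"])
        (unfold 6 turan_prism_closed_forms, simp_all add: algebra_simps)
  qed
qed

section \<open>The extremal number\<close>

lemma ex_prism:
  assumes "n \<noteq> 5"
  shows "ex n prism = turan_prism n"
  unfolding ex_def
proof (rule Max_eqI[OF finite_ex_set])
  fix m assume "m \<in> {card (edges G) | G :: nat sgraph.
     simple_graph G \<and> card (verts G) = n \<and> \<not> contains_copy G prism}"
  then obtain G :: "nat sgraph" where G: "m = card (edges G)" "simple_graph G" "card (verts G) = n"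
    "\<not> contains_copy G prism" by blast
  then show "m \<le> turan_prism n"
    using prism_free_edges_le[of "verts G" "edges G"] prism_free_graph_iff[OF G(2)] assms by simp
next
  obtain a t where at: "3 * t \<le> a" "a \<le> n" "a * (n - a) + 3 * t = turan_prism n"
    by (rule extremal_parameters)
  let ?G = "extremal_graph a t n"
  have "turan_prism n = card (edges ?G)" using card_extremal_graph[OF at(1)] at(3) by simp
  moreover have "card (verts ?G) = n" by (simp add: extremal_graph_def)
  ultimately show "turan_prism n \<in> {card (edges G) | G :: nat sgraph.
     simple_graph G \<and> card (verts G) = n \<and> \<not> contains_copy G prism}"
    using simple_extremal_graph[OF at(1,2)] extremal_graph_prism_free[OF at(1)] by blast
qed

theorem theorem1p2:
  fixes n :: nat
  assumes "n \<ge> 1" and "n \<noteq> 5"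
  shows "int (ex n prism) =
    (if n mod 6 \<in> {1, 2, 3}
     then \<lfloor>(real n)\<^sup>2 / 4\<rfloor> + \<lfloor>(real n - 1) / 2\<rfloor>
     else \<lfloor>(real n)\<^sup>2 / 4\<rfloor> + \<lceil>real n / 2\<rceil>)"
proof -
  have sq: "\<lfloor>(real n)\<^sup>2 / 4\<rfloor> = int (n\<^sup>2 div 4)"
    using floor_divide_of_nat_eq[of "n\<^sup>2" 4] by simp
  \<comment> \<open>\<open>n \<ge> 1\<close> makes natural subtraction agree with the real
    one.\<close>
  have lower: "\<lfloor>(real n - 1) / 2\<rfloor> = int ((n - 1) div 2)"
    using floor_divide_of_nat_eq[of "n - 1" 2] assms(1) by (simp add: of_nat_diff)
  have upper: "\<lceil>real n / 2\<rceil> = int ((n + 1) div 2)"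
  proof (cases "even n")
    case True
    then show ?thesis by (auto elim!: evenE)
  next
    case False
    then obtain k where "n = 2 * k + 1" by (rule oddE)
    then show ?thesis by (simp add: ceiling_eq_iff)
  qed
  show ?thesis
    unfolding ex_prism[OF assms(2)] sq lower upper turan_prism_def by simp
qed

end
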